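(* Let $G_1$ be the group generated by the permutations of the parameters $c_0,c_1,c_2,c_3,c_4,c_5$ and the Bailey transformation $b$ of parameters for the elliptic ${}_{10}E_9$ series, both acting linearly on vectors ${}^t[s,c_0,c_1,c_2,c_3,c_4,c_5,\delta]$ as described in the context. Then $G_1$ is isomorphic to the Weyl group $W(E_6)$ associated to the root system $E_6$.
   Context: The transformations act on $\mathbb{C}^8$ with coordinates ${}^t[s,c_0,c_1,c_2,c_3,c_4,c_5,\delta]$. A permutation of the parameters permutes the coordinates $c_0,\dots,c_5$ and fixes $s$ and $\delta$. The Bailey transformation is $$b:\ (s,c_0,c_1,c_2,c_3,c_4,c_5,\delta)\mapsto(2s+\delta-c_0-c_1-c_2,\ s+\delta-c_1-c_2,\ s+\delta-c_0-c_2,\ s+\delta-c_0-c_1,\ c_3,\ c_4,\ c_5,\ \delta).$$ The group operation is composition. *)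

theory Defs
  imports "HOL-Analysis.Analysis" "HOL-Algebra.Bij" "HOL-Algebra.Generated_Groups"
begin

section \<open>Transformations of the parameters\<close>

text \<open>
  A vector (s, c0, c1, c2, c3, c4, c5, delta) is an element x of \<^typ>\<open>complex ^ 8\<close> with
  s = x$1, ck = x$(k+2) and delta = x$8.  (In the index type 8 the numeral 8 denotes the
  same element as 0; the elements 1, ..., 8 are pairwise distinct.)
\<close>

definition param_indices :: "8 set" where
  "param_indices = {2, 3, 4, 5, 6, 7}"

definition permute_params :: "(8 \<Rightarrow> 8) \<Rightarrow> complex ^ 8 \<Rightarrow> complex ^ 8" where
  "permute_params \<pi> x = (\<chi> i. x $ \<pi> i)"

definition bailey :: "complex ^ 8 \<Rightarrow> complex ^ 8" where
  "bailey x =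
    (let s = x $ 1; c0 = x $ 2; c1 = x $ 3; c2 = x $ 4;
         c3 = x $ 5; c4 = x $ 6; c5 = x $ 7; \<delta> = x $ 8
     in vector [2 * s + \<delta> - c0 - c1 - c2,
                s + \<delta> - c1 - c2, s + \<delta> - c0 - c2, s + \<delta> - c0 - c1,
                c3, c4, c5, \<delta>])"

definition G1_generators :: "(complex ^ 8 \<Rightarrow> complex ^ 8) set" where
  "G1_generators = insert bailey {permute_params \<pi> | \<pi>. \<pi> permutes param_indices}"

definition G1 :: "(complex ^ 8 \<Rightarrow> complex ^ 8) monoid" where
  "G1 = subgroup_generated (BijGroup UNIV) G1_generators"

text \<open>
  \<^const>\<open>subgroup_generated\<close> discards proposed generators outside the ambient group.  The
  following facts show that nothing is discarded, and that the generators act linearly.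
\<close>

lemma vector_8:
  "(vector [a, b, c, d, e, f, g, h] :: 'a::zero ^ 8) $ 1 = a"
  "(vector [a, b, c, d, e, f, g, h] :: 'a ^ 8) $ 2 = b"
  "(vector [a, b, c, d, e, f, g, h] :: 'a ^ 8) $ 3 = c"
  "(vector [a, b, c, d, e, f, g, h] :: 'a ^ 8) $ 4 = d"
  "(vector [a, b, c, d, e, f, g, h] :: 'a ^ 8) $ 5 = e"
  "(vector [a, b, c, d, e, f, g, h] :: 'a ^ 8) $ 6 = f"
  "(vector [a, b, c, d, e, f, g, h] :: 'a ^ 8) $ 7 = g"
  "(vector [a, b, c, d, e, f, g, h] :: 'a ^ 8) $ 8 = h"
  by (simp_all add: vector_def)

lemma exhaust_8:
  fixes i :: 8
  shows "i = 1 \<or> i = 2 \<or> i = 3 \<or> i = 4 \<or> i = 5 \<or> i = 6 \<or> i = 7 \<or> i = 8"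
proof (induct i)
  case (of_int z)
  then have "0 \<le> z" "z < 8"
    by simp_all
  then have "z = 0 \<or> z = 1 \<or> z = 2 \<or> z = 3 \<or> z = 4 \<or> z = 5 \<or> z = 6 \<or> z = 7"
    by arith
  then show ?case
    by auto
qed

lemma forall_8:
  "(\<forall>i::8. P i) \<longleftrightarrow> P 1 \<and> P 2 \<and> P 3 \<and> P 4 \<and> P 5 \<and> P 6 \<and> P 7 \<and> P 8"
  by (metis exhaust_8)

lemma permute_params_linear: "Vector_Spaces.linear (*s) (*s) (permute_params \<pi>)"
  by unfold_locales (simp_all add: permute_params_def vec_eq_iff algebra_simps)

lemma bailey_linear: "Vector_Spaces.linear (*s) (*s) bailey"
  by unfold_locales
    (simp_all add: bailey_def Let_def vec_eq_iff forall_8 vector_8 algebra_simps)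

lemma bailey_involution: "bailey (bailey x) = x"
  by (simp add: bailey_def Let_def vec_eq_iff forall_8 vector_8)

lemma bij_permute_params:
  assumes "\<pi> permutes param_indices"
  shows "bij (permute_params \<pi>)"
  by (rule o_bij[where g = "permute_params (inv_into UNIV \<pi>)"])
    (simp_all add: fun_eq_iff permute_params_def permutes_inverses[OF assms])

lemma G1_generators_subset: "G1_generators \<subseteq> carrier (BijGroup UNIV)"
proof -
  have "bij bailey"
    by (rule o_bij[where g = bailey]) (simp_all add: fun_eq_iff bailey_involution)
  then show ?thesis
    by (auto simp: G1_generators_def BijGroup_def Bij_def bij_permute_params)
qed


section \<open>Weyl groups and the root system $E_6$\<close>

definition reflection :: "'a::euclidean_space \<Rightarrow> 'a \<Rightarrow> 'a" where
  "reflection \<alpha> x = x - (2 * (x \<bullet> \<alpha>) / (\<alpha> \<bullet> \<alpha>)) *\<^sub>R \<alpha>"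

text \<open>
  A root system spans the space on which its Weyl group acts, so reflections are restricted
  to the span; \<^const>\<open>BijGroup\<close> requires them to be extensional outside it.
\<close>

definition weyl_group :: "'a::euclidean_space set \<Rightarrow> ('a \<Rightarrow> 'a) monoid" where
  "weyl_group \<Phi> =
     subgroup_generated (BijGroup (span \<Phi>)) ((\<lambda>\<alpha>. restrict (reflection \<alpha>) (span \<Phi>)) ` \<Phi>)"

lemma reflection_in_BijGroup:
  assumes "\<alpha> \<in> \<Phi>"
  shows "restrict (reflection \<alpha>) (span \<Phi>) \<in> carrier (BijGroup (span \<Phi>))"
proof -
  have invol: "reflection \<alpha> (reflection \<alpha> x) = x" for x
    by (cases "\<alpha> = 0") (simp_all add: reflection_def inner_diff_left)
  have closed: "reflection \<alpha> x \<in> span \<Phi>" if "x \<in> span \<Phi>" for x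
    unfolding reflection_def by (rule span_diff[OF that span_scale[OF span_base[OF assms]]])
  have "bij_betw (reflection \<alpha>) (span \<Phi>) (span \<Phi>)"
    by (rule bij_betw_byWitness[where f' = "reflection \<alpha>"]) (auto simp: invol closed)
  then show ?thesis
    by (simp add: BijGroup_def Bij_def)
qed

text \<open>
  Bourbaki's coordinates (Lie Groups and Lie Algebras, Plate V): the 40 vectors
  $\pm e_i \pm e_j$ with $1 \le i < j \le 5$ and the 32 vectors
  $\pm \frac12 (e_8 - e_7 - e_6 + \sum_{i=1}^5 (-1)^{\nu(i)} e_i)$ with
  $\sum_{i=1}^5 \nu(i)$ even.
\<close>

definition unit_vec :: "8 \<Rightarrow> real ^ 8" where
  "unit_vec i = axis i 1"

definition E6 :: "(real ^ 8) set" where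
  "E6 =
     {a *\<^sub>R unit_vec i + b *\<^sub>R unit_vec j | a b i j.
        a \<in> {1, -1} \<and> b \<in> {1, -1} \<and> i \<in> {1, 2, 3, 4, 5} \<and> j \<in> {1, 2, 3, 4, 5} \<and> i \<noteq> j}
   \<union> {(a / 2) *\<^sub>R (unit_vec 8 - unit_vec 7 - unit_vec 6
          + (\<Sum>i\<in>{1, 2, 3, 4, 5}. (-1) ^ \<nu> i *\<^sub>R unit_vec i)) | a \<nu>.
        a \<in> {1, -1} \<and> even (\<Sum>i\<in>{1, 2, 3, 4, 5}. \<nu> i :: nat)}"

end

theory Submission
  imports Defs
begin

text \<open>
  Every generator of the parameter group is a reflection or a product of reflections.  The
  transposition of \<open>c\<^sub>i\<close> and \<open>c\<^sub>j\<close> is \<open>x \<mapsto> x - (c\<^sub>i - c\<^sub>j)(e\<^sub>i - e\<^sub>j)\<close>, and the Bailey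
  transformation is \<open>x \<mapsto> x + (s + \<delta> - c\<^sub>0 - c\<^sub>1 - c\<^sub>2) v\<close>, where \<open>v\<close> has the entry 1 at
  \<open>s, c\<^sub>0, c\<^sub>1, c\<^sub>2\<close> and 0 elsewhere.  The five adjacent transpositions form a chain; the Bailey
  reflection commutes with all of them except the transposition of \<open>c\<^sub>2\<close> and \<open>c\<^sub>3\<close>, the middle
  one.  This is the Dynkin diagram of \<open>E\<^sub>6\<close>.

  Instead of comparing presentations by generators and relations, the proof compares the two
  representations.  Let \<open>V\<close> be the span of the roots, of dimension 6.  There are linear maps
  \<open>T : V \<rightarrow> \<real>\<^sup>8\<close> (\<open>from_roots\<close>) and \<open>P : \<real>\<^sup>8 \<rightarrow> V\<close> (\<open>to_roots\<close>) with \<open>P T = id\<close>, where \<open>T\<close> sends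
  roots to the vectors \<open>e\<^sub>i - e\<^sub>j\<close>, \<open>v\<close>, ... above and \<open>P\<close> encodes the linear forms that go with
  them.  Hence \<open>\<real>\<^sup>8 = T V \<oplus> ker P\<close>, and a bijection \<open>w\<close> of \<open>V\<close> acts on \<open>\<real>\<^sup>8\<close> by
  \<open>v \<mapsto> v + T (w (P v) - P v)\<close>: it moves the first component as \<open>w\<close> does and keeps the second.
  Applying this to real and imaginary parts gives an injective homomorphism (\<open>action_mon\<close>) from
  the bijections of \<open>V\<close> to those of \<open>\<complex>\<^sup>8\<close>, for which no relation has to be checked.

  It remains to compare generators.  The reflections in a small set of roots already generate the
  Weyl group (\<open>weyl_group_E6\<close>), and their images are exactly the Bailey transformation and
  the transpositions of two parameters, which generate the parameter group (\<open>G1_eq\<close>).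
\<close>

section \<open>Roots\<close>

definition D5_indices :: "8 set" where
  "D5_indices = {1, 2, 3, 4, 5}"

text \<open>
  The first five coordinates form a weight of a half-spin representation of the subsystem \<open>D\<^sub>5\<close>, and
  the last three complete it to a vector of squared length 2; \<open>A\<close> is the set of those among the
  first five coordinates that carry a minus sign.
\<close>

definition half_spin :: "8 set \<Rightarrow> real ^ 8" where
  "half_spin A = (1 / 2) *\<^sub>R (unit_vec 8 - unit_vec 7 - unit_vec 6
     + (\<Sum>i\<in>D5_indices. (if i \<in> A then -1 else 1) *\<^sub>R unit_vec i))"

text \<open>
  The simple roots of Bourbaki's basis are among these.  The set is larger than a basis because it
  collects, up to sign, the roots that correspond to the Bailey transformation and to all
  transpositions of two parameters: the half-spin roots exchange
  \<open>c\<^sub>0\<close> with another parameter, the differences exchange two of \<open>c\<^sub>1, \<dots>, c\<^sub>5\<close>.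
\<close>

definition generating_roots :: "(real ^ 8) set" where
  "generating_roots =
     {unit_vec i - unit_vec j | i j. i \<in> D5_indices \<and> j \<in> D5_indices \<and> i \<noteq> j}
   \<union> {unit_vec 1 + unit_vec 2}
   \<union> {half_spin (D5_indices - {i}) | i. i \<in> D5_indices}"

lemma finite_D5_indices [simp]: "finite D5_indices"
  by (simp add: D5_indices_def)

lemma card_D5_indices [simp]: "card D5_indices = 5"
  by (simp add: D5_indices_def)

lemma UNIV_8: "(UNIV :: 8 set) = {1, 2, 3, 4, 5, 6, 7, 8}"
  using exhaust_8 by auto

lemma sum_8: "(\<Sum>i\<in>UNIV. f (i::8)) = f 1 + f 2 + f 3 + f 4 + f 5 + f 6 + f 7 + f 8"
  unfolding UNIV_8 by (simp add: add.assoc)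

lemma unit_vec_component: "unit_vec i $ j = (if j = i then 1 else 0)"
  by (simp add: unit_vec_def axis_def)

lemma inner_unit_vec [simp]: "x \<bullet> unit_vec i = x $ i"
  by (simp add: unit_vec_def inner_axis)

lemma unit_vec_inner_unit_vec: "unit_vec i \<bullet> unit_vec j = (if i = j then 1 else 0)"
  by (simp add: unit_vec_component)

lemma half_spin_component:
  "half_spin A $ i =
     (if i \<in> D5_indices then if i \<in> A then -1 / 2 else 1 / 2
      else if i = 8 then 1 / 2 else -1 / 2)"
  using exhaust_8[of i]
  by (elim disjE) (simp_all add: half_spin_def unit_vec_component D5_indices_def)

lemma half_spin_last_components:
  "half_spin A $ 6 = -1 / 2" "half_spin A $ 7 = -1 / 2" "half_spin A $ 8 = 1 / 2"
  by (simp_all add: half_spin_component D5_indices_def)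

lemma half_spin_norm: "half_spin A \<bullet> half_spin A = 2"
proof -
  have "half_spin A $ k * half_spin A $ k = 1 / 4" for k
    by (simp add: half_spin_component)
  then show ?thesis
    by (simp only: inner_vec_def inner_real_def) simp
qed

lemma generating_rootsI:
  "i \<in> D5_indices \<Longrightarrow> j \<in> D5_indices \<Longrightarrow> i \<noteq> j \<Longrightarrow> unit_vec i - unit_vec j \<in> generating_roots"
  "unit_vec 1 + unit_vec 2 \<in> generating_roots"
  "i \<in> D5_indices \<Longrightarrow> half_spin (D5_indices - {i}) \<in> generating_roots"
  unfolding generating_roots_def
  by (rule UnI1, rule UnI1, rule CollectI, intro exI conjI refl)
    (assumption | rule UnI1 UnI2 singletonI CollectI exI conjI refl)+

lemma generating_rootsE:
  assumes "\<alpha> \<in> generating_roots"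
  obtains (minus) i j where "i \<in> D5_indices" "j \<in> D5_indices" "i \<noteq> j" "\<alpha> = unit_vec i - unit_vec j"
    | (plus) "\<alpha> = unit_vec 1 + unit_vec 2"
    | (spin) i where "i \<in> D5_indices" "\<alpha> = half_spin (D5_indices - {i})"
  using assms unfolding generating_roots_def
  by (elim UnE CollectE exE conjE singletonE)

text \<open>
  Up to a common sign, the two signs of an integral root only distinguish sums from differences,
  and the exponents of a half-integral root only matter through the set where they are odd.
\<close>

lemma E6_iff:
  "\<alpha> \<in> E6 \<longleftrightarrow>
     (\<exists>i\<in>D5_indices. \<exists>j\<in>D5_indices. i \<noteq> j \<and>
        (\<exists>a\<in>{1, -1}. \<alpha> = a *\<^sub>R (unit_vec i + unit_vec j) \<or> \<alpha> = a *\<^sub>R (unit_vec i - unit_vec j)))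
   \<or> (\<exists>A\<subseteq>D5_indices. even (card A) \<and> (\<exists>a\<in>{1, -1}. \<alpha> = a *\<^sub>R half_spin A))"
  (is "_ \<longleftrightarrow> ?D \<or> ?S")
proof -
  have D: "(\<exists>a b i j. \<alpha> = a *\<^sub>R unit_vec i + b *\<^sub>R unit_vec j \<and>
        a \<in> {1, -1} \<and> b \<in> {1, -1} \<and> i \<in> D5_indices \<and> j \<in> D5_indices \<and> i \<noteq> j) \<longleftrightarrow> ?D"
    (is "?L \<longleftrightarrow> _")
  proof
    assume ?L
    then obtain a b i j where *: "\<alpha> = a *\<^sub>R unit_vec i + b *\<^sub>R unit_vec j"
      "a \<in> {1, -1}" "b \<in> {1, -1}" "i \<in> D5_indices" "j \<in> D5_indices" "i \<noteq> j"
      by blast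
    have "\<alpha> = a *\<^sub>R (unit_vec i + unit_vec j) \<or> \<alpha> = a *\<^sub>R (unit_vec i - unit_vec j)"
      using *(2,3) unfolding *(1) by (auto simp: algebra_simps)
    with *(2,4-6) show ?D
      by blast
  next
    assume ?D
    then obtain a i j where *: "i \<in> D5_indices" "j \<in> D5_indices" "i \<noteq> j" "a \<in> {1, -1}"
      "\<alpha> = a *\<^sub>R (unit_vec i + unit_vec j) \<or> \<alpha> = a *\<^sub>R (unit_vec i - unit_vec j)"
      by blast
    then have "\<alpha> = a *\<^sub>R unit_vec i + a *\<^sub>R unit_vec j \<or> \<alpha> = a *\<^sub>R unit_vec i + (-a) *\<^sub>R unit_vec j"
      by (auto simp: algebra_simps)
    moreover have "-a \<in> {1, -1}"
      using *(4) by auto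
    ultimately show ?L
      using * by blast
  qed
  have half_spin_eq: "a *\<^sub>R half_spin {i \<in> D5_indices. odd (\<nu> i)} =
      (a / 2) *\<^sub>R (unit_vec 8 - unit_vec 7 - unit_vec 6
        + (\<Sum>i\<in>D5_indices. (-1) ^ \<nu> i *\<^sub>R unit_vec i))" for a and \<nu> :: "8 \<Rightarrow> nat"
  proof -
    have "(\<Sum>i\<in>D5_indices. (if i \<in> {i \<in> D5_indices. odd (\<nu> i)} then -1 else 1 :: real) *\<^sub>R unit_vec i)
        = (\<Sum>i\<in>D5_indices. (-1) ^ \<nu> i *\<^sub>R unit_vec i)"
      by (intro sum.cong refl) auto
    then show ?thesis
      by (simp only: half_spin_def scaleR_scaleR) simp
  qed
  have S: "(\<exists>a \<nu>. \<alpha> = (a / 2) *\<^sub>R (unit_vec 8 - unit_vec 7 - unit_vec 6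
        + (\<Sum>i\<in>D5_indices. (-1) ^ \<nu> i *\<^sub>R unit_vec i)) \<and>
        a \<in> {1, -1} \<and> even (\<Sum>i\<in>D5_indices. \<nu> i :: nat)) \<longleftrightarrow> ?S"
    (is "?L \<longleftrightarrow> _")
  proof
    assume ?L
    then obtain a and \<nu> :: "8 \<Rightarrow> nat" where *: "a \<in> {1, -1}" "even (sum \<nu> D5_indices)"
      "\<alpha> = a *\<^sub>R half_spin {i \<in> D5_indices. odd (\<nu> i)}"
      unfolding half_spin_eq by blast
    from *(2) have "even (card {i \<in> D5_indices. odd (\<nu> i)})"
      by (subst (asm) even_sum_iff) simp_all
    then show ?S
      using *(1,3) by (intro exI[of _ "{i \<in> D5_indices. odd (\<nu> i)}"] conjI bexI[of _ a] Collect_subset)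
  next
    assume ?S
    then obtain a A where *: "A \<subseteq> D5_indices" "even (card A)" "a \<in> {1, -1}" "\<alpha> = a *\<^sub>R half_spin A"
      by (elim exE conjE bexE)
    define \<nu> :: "8 \<Rightarrow> nat" where "\<nu> i = (if i \<in> A then 1 else 0)" for i
    have A: "{i \<in> D5_indices. odd (\<nu> i)} = A"
      using *(1) by (auto simp: \<nu>_def)
    then have "even (sum \<nu> D5_indices)"
      using *(2) by (subst even_sum_iff) simp_all
    moreover have "\<alpha> = (a / 2) *\<^sub>R (unit_vec 8 - unit_vec 7 - unit_vec 6
        + (\<Sum>i\<in>D5_indices. (-1) ^ \<nu> i *\<^sub>R unit_vec i))"
      unfolding *(4) by (simp only: A flip: half_spin_eq)
    ultimately show ?L
      using *(3) by (intro exI[of _ a] exI[of _ \<nu>] conjI)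
  qed
  show ?thesis
    unfolding E6_def D5_indices_def[symmetric] Un_iff mem_Collect_eq D S ..
qed

lemma D5_roots:
  assumes "i \<in> D5_indices" "j \<in> D5_indices" "i \<noteq> j"
  shows "unit_vec i + unit_vec j \<in> E6" "unit_vec i - unit_vec j \<in> E6"
proof -
  show "unit_vec i + unit_vec j \<in> E6"
    unfolding E6_iff
    by (rule disjI1, rule bexI[OF _ assms(1)], rule bexI[OF _ assms(2)], rule conjI[OF assms(3)],
      rule bexI[of _ 1]) simp_all
  show "unit_vec i - unit_vec j \<in> E6"
    unfolding E6_iff
    by (rule disjI1, rule bexI[OF _ assms(1)], rule bexI[OF _ assms(2)], rule conjI[OF assms(3)],
      rule bexI[of _ 1]) simp_all
qed

lemma half_spin_root:
  assumes "A \<subseteq> D5_indices" "even (card A)"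
  shows "half_spin A \<in> E6"
  unfolding E6_iff
  using assms by (intro disjI2 exI[of _ A] conjI bexI[of _ 1]; simp)

lemma generating_roots_subset: "generating_roots \<subseteq> E6"
proof -
  have "half_spin (D5_indices - {i}) \<in> E6" if "i \<in> D5_indices" for i
  proof (rule half_spin_root)
    have "card (D5_indices - {i}) = 4"
      using that by (subst card_Diff_singleton) simp_all
    then show "even (card (D5_indices - {i}))"
      by simp
  qed (rule Diff_subset)
  moreover have "unit_vec 1 + unit_vec 2 \<in> E6"
    by (rule D5_roots) (simp_all add: D5_indices_def)
  ultimately show ?thesis
    using D5_roots(2) by (auto elim!: generating_rootsE)
qed

text \<open>
  Half-sums of \<open>e\<^sub>i + e\<^sub>j\<close> and \<open>e\<^sub>i - e\<^sub>j\<close> give the first five unit vectors, and one half-spin root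
  supplies the remaining direction \<open>e\<^sub>8 - e\<^sub>7 - e\<^sub>6\<close>.
\<close>

lemma span_E6: "span E6 = {y. y $ 6 = y $ 7 \<and> y $ 7 = - (y $ 8)}"
proof
  have D5: "unit_vec i $ 6 = 0 \<and> unit_vec i $ 7 = 0 \<and> unit_vec i $ 8 = 0" if "i \<in> D5_indices" for i
    using that by (auto simp: D5_indices_def unit_vec_component)
  have "y $ 6 = y $ 7 \<and> y $ 7 = - (y $ 8)" if "y \<in> E6" for y
    using that unfolding E6_iff
    by (elim disjE bexE exE conjE) (simp_all add: D5 half_spin_last_components)
  moreover have "subspace {y :: real ^ 8. y $ 6 = y $ 7 \<and> y $ 7 = - (y $ 8)}"
    by (auto simp: subspace_def)
  ultimately show "span E6 \<subseteq> {y. y $ 6 = y $ 7 \<and> y $ 7 = - (y $ 8)}"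
    by (intro span_minimal) auto
next
  have root: "\<alpha> \<in> span E6" if "\<alpha> \<in> E6" for \<alpha>
    using that by (rule span_base)
  have D5: "unit_vec i \<in> span E6" if "i \<in> D5_indices" for i
  proof -
    define j :: 8 where "j = (if i = 1 then 2 else 1)"
    have j: "j \<in> D5_indices" "i \<noteq> j"
      by (auto simp: j_def D5_indices_def)
    have "unit_vec i + unit_vec j \<in> span E6" "unit_vec i - unit_vec j \<in> span E6"
      using D5_roots[OF that j] root by simp_all
    then have "(1 / 2) *\<^sub>R ((unit_vec i + unit_vec j) + (unit_vec i - unit_vec j)) \<in> span E6"
      by (intro span_scale) (rule span_add)
    also have "(1 / 2) *\<^sub>R ((unit_vec i + unit_vec j) + (unit_vec i - unit_vec j)) = unit_vec i"
      by (simp add: vec_eq_iff)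
    finally show ?thesis .
  qed
  have spin: "half_spin {} \<in> span E6"
    by (rule root[OF half_spin_root]) simp_all
  show "{y. y $ 6 = y $ 7 \<and> y $ 7 = - (y $ 8)} \<subseteq> span E6"
  proof safe
    fix y :: "real ^ 8"
    assume y: "y $ 6 = y $ 7" "y $ 7 = - (y $ 8)"
    have "y = (2 * y $ 8) *\<^sub>R half_spin {} + (\<Sum>i\<in>D5_indices. (y $ i - y $ 8) *\<^sub>R unit_vec i)"
      using y by (simp add: vec_eq_iff forall_8 half_spin_component unit_vec_component D5_indices_def)
    also have "\<dots> \<in> span E6"
      using spin D5 by (intro span_add span_scale span_sum)
    finally show "y \<in> span E6" .
  qed
qed


section \<open>Reflections\<close>

lemma reflection_scale:
  assumes "c \<noteq> 0"
  shows "reflection (c *\<^sub>R \<alpha>) = reflection \<alpha>"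
  using assms by (simp add: reflection_def fun_eq_iff field_simps)

text \<open>
  A reflection is an isometry, so conjugating by it carries the reflection in a vector to the
  reflection in the image of that vector.
\<close>

lemma reflection_reflection:
  "reflection (reflection \<beta> \<alpha>) x = reflection \<beta> (reflection \<alpha> (reflection \<beta> x))"
proof (cases "\<beta> = 0")
  case False
  define b where "b = \<beta> \<bullet> \<beta>"
  have b: "b \<noteq> 0"
    using False by (simp add: b_def)
  have norm: "reflection \<beta> \<alpha> \<bullet> reflection \<beta> \<alpha> = \<alpha> \<bullet> \<alpha>"
    using b unfolding reflection_def
    by (simp add: inner_simps inner_commute[of \<beta> \<alpha>] flip: b_def)
  have adj: "x \<bullet> reflection \<beta> \<alpha> = reflection \<beta> x \<bullet> \<alpha>"
    by (simp add: reflection_def inner_simps inner_commute)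
  have invol: "reflection \<beta> (reflection \<beta> x) = x"
    using False by (simp add: reflection_def inner_diff_left)
  have lin: "reflection \<beta> (u - c *\<^sub>R v) = reflection \<beta> u - c *\<^sub>R reflection \<beta> v" for u v c
    by (simp add: reflection_def inner_simps algebra_simps diff_divide_distrib)
  have "reflection \<beta> (reflection \<alpha> (reflection \<beta> x))
      = x - (2 * (reflection \<beta> x \<bullet> \<alpha>) / (\<alpha> \<bullet> \<alpha>)) *\<^sub>R reflection \<beta> \<alpha>"
    by (subst (2) reflection_def) (simp add: lin invol)
  then show ?thesis
    by (subst reflection_def) (simp add: norm adj)
qed (simp add: reflection_def)

definition restricted_reflection :: "'a::euclidean_space set \<Rightarrow> 'a \<Rightarrow> 'a \<Rightarrow> 'a" where
  "restricted_reflection S \<alpha> = restrict (reflection \<alpha>) S"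

lemma restricted_reflection_scale:
  "c \<noteq> 0 \<Longrightarrow> restricted_reflection S (c *\<^sub>R \<alpha>) = restricted_reflection S \<alpha>"
  by (simp add: restricted_reflection_def reflection_scale)

lemma restricted_reflection_in_Bij:
  "\<alpha> \<in> span \<Phi> \<Longrightarrow> restricted_reflection (span \<Phi>) \<alpha> \<in> Bij (span \<Phi>)"
  using reflection_in_BijGroup[of \<alpha> "span \<Phi>"]
  by (simp add: restricted_reflection_def BijGroup_def span_span)

lemma root_reflections_in_BijGroup:
  "restricted_reflection (span \<Phi>) ` \<Phi> \<subseteq> carrier (BijGroup (span \<Phi>))"
  by (rule image_subsetI) (simp add: BijGroup_def restricted_reflection_in_Bij span_base)

lemma reflection_in_span:
  "\<alpha> \<in> span \<Phi> \<Longrightarrow> x \<in> span \<Phi> \<Longrightarrow> reflection \<alpha> x \<in> span \<Phi>"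
  unfolding reflection_def by (intro span_diff span_scale)

text \<open>
  The roots whose reflections lie in a given subgroup are therefore closed under reflection in one
  another; new roots are obtained from old ones without any computation in the group.
\<close>

lemma restricted_reflection_conjugate:
  assumes "subgroup K (BijGroup (span \<Phi>))" "\<alpha> \<in> span \<Phi>" "\<beta> \<in> span \<Phi>"
    and "restricted_reflection (span \<Phi>) \<alpha> \<in> K" "restricted_reflection (span \<Phi>) \<beta> \<in> K"
  shows "restricted_reflection (span \<Phi>) (reflection \<beta> \<alpha>) \<in> K"
proof -
  let ?B = "BijGroup (span \<Phi>)" and ?r = "restricted_reflection (span \<Phi>)"
  have mem: "?r \<alpha> \<in> Bij (span \<Phi>)" "?r \<beta> \<in> Bij (span \<Phi>)"
    by (rule restricted_reflection_in_Bij[OF assms(2)], rule restricted_reflection_in_Bij[OF assms(3)])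
  have "?r \<beta> \<otimes>\<^bsub>?B\<^esub> (?r \<alpha> \<otimes>\<^bsub>?B\<^esub> ?r \<beta>) = ?r (reflection \<beta> \<alpha>)"
  proof -
    have "?r \<beta> \<otimes>\<^bsub>?B\<^esub> (?r \<alpha> \<otimes>\<^bsub>?B\<^esub> ?r \<beta>) =
        compose (span \<Phi>) (?r \<beta>) (compose (span \<Phi>) (?r \<alpha>) (?r \<beta>))"
      using mem by (simp add: BijGroup_def compose_Bij)
    also have "\<dots> = ?r (reflection \<beta> \<alpha>)"
      using assms(2,3)
      by (auto simp: compose_def restricted_reflection_def reflection_reflection
          reflection_in_span fun_eq_iff)
    finally show ?thesis .
  qed
  moreover have "?r \<beta> \<otimes>\<^bsub>?B\<^esub> (?r \<alpha> \<otimes>\<^bsub>?B\<^esub> ?r \<beta>) \<in> K"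
    using assms(1,4,5) by (intro subgroup.m_closed)
  ultimately show ?thesis
    by simp
qed

text \<open>
  Reflection in \<open>e\<^sub>i - e\<^sub>k\<close> swaps two coordinates, which carries \<open>e\<^sub>1 + e\<^sub>2\<close> to every
  \<open>e\<^sub>i + e\<^sub>j\<close>.  Reflection in \<open>e\<^sub>i + e\<^sub>j\<close> in turn removes two minus signs at once from a half-spin root,
  so starting from four minus signs every even set of them is reached.
\<close>

lemma generating_reflections_generate:
  assumes K: "subgroup K (BijGroup (span E6))"
    and gen: "restricted_reflection (span E6) ` generating_roots \<subseteq> K"
    and \<alpha>: "\<alpha> \<in> E6"
  shows "restricted_reflection (span E6) \<alpha> \<in> K"
proof -
  let ?r = "restricted_reflection (span E6)"
  note conj = restricted_reflection_conjugate[OF K]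
  have D5: "unit_vec i \<in> span E6" if "i \<in> D5_indices" for i
    using that unfolding span_E6 by (auto simp: unit_vec_component D5_indices_def)
  have spin: "half_spin A \<in> span E6" for A
    unfolding span_E6 by (simp add: half_spin_last_components)
  have minus: "?r (unit_vec i - unit_vec j) \<in> K"
    if "i \<in> D5_indices" "j \<in> D5_indices" "i \<noteq> j" for i j
    using generating_rootsI(1)[OF that] gen by blast
  have move: "?r (unit_vec k + unit_vec j) \<in> K"
    if "?r (unit_vec i + unit_vec j) \<in> K" "i \<in> D5_indices" "j \<in> D5_indices" "k \<in> D5_indices"
      "i \<noteq> j" "k \<noteq> j" for i j k
  proof (cases "i = k")
    case False
    have "reflection (unit_vec i - unit_vec k) (unit_vec i + unit_vec j) = unit_vec k + unit_vec j"
      using that False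
      by (simp add: reflection_def inner_simps unit_vec_inner_unit_vec unit_vec_component)
    moreover have "?r (reflection (unit_vec i - unit_vec k) (unit_vec i + unit_vec j)) \<in> K"
      using that False D5 minus by (intro conj span_add span_diff)
    ultimately show ?thesis
      by simp
  qed (use that in simp)
  have "?r (unit_vec 1 + unit_vec 2) \<in> K"
    using generating_rootsI(2) gen by blast
  then have plus_2: "?r (unit_vec k + unit_vec 2) \<in> K" if "k \<in> D5_indices" "k \<noteq> 2" for k
    using that by (intro move[of 1 2 k]) (simp_all add: D5_indices_def)
  have plus: "?r (unit_vec i + unit_vec j) \<in> K"
    if "i \<in> D5_indices" "j \<in> D5_indices" "i \<noteq> j" for i j
  proof (cases "i = 2")
    case True
    then show ?thesis
      using that plus_2[of j] by (simp add: add.commute)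
  next
    case False
    then have "?r (unit_vec 2 + unit_vec i) \<in> K"
      using that plus_2[of i] by (simp add: add.commute)
    then have "?r (unit_vec j + unit_vec i) \<in> K"
      using that False by (intro move[of 2 i j]) (simp_all add: D5_indices_def)
    then show ?thesis
      by (simp add: add.commute)
  qed
  have half_spin: "?r (half_spin A) \<in> K" if "A \<subseteq> D5_indices" "even (card A)" for A
    using that
  \<comment> \<open>Fewer plus signs come first: the base case has a single plus sign, the number of plus
    signs being odd.\<close>
  proof (induction "card (D5_indices - A)" arbitrary: A rule: less_induct)
    case less
    have fin: "finite A"
      using less.prems(1) by (rule finite_subset) simp
    have card: "card (D5_indices - A) + card A = 5"
      using less.prems(1) card_mono[OF _ less.prems(1)] fin by (subst card_Diff_subset) simp_all
    then have "card (D5_indices - A) \<noteq> 0"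
      using less.prems(2) by presburger
    then obtain i where i: "i \<in> D5_indices - A"
      by (metis card.empty equals0I)
    show ?case
    proof (cases "D5_indices - A = {i}")
      case True
      then have "A = D5_indices - {i}"
        using less.prems(1) by blast
      then show ?thesis
        using generating_rootsI(3)[of i] gen i by (metis DiffD1 imageI subsetD)
    next
      case False
      then obtain j where j: "j \<in> D5_indices - A" "i \<noteq> j"
        using i by blast
      let ?B = "insert i (insert j A)"
      have "?r (half_spin ?B) \<in> K"
      proof (rule less.hyps)
        show "card (D5_indices - ?B) < card (D5_indices - A)"
          using i j by (intro psubset_card_mono) auto
        show "?B \<subseteq> D5_indices"
          using i j less.prems(1) by simp
        show "even (card ?B)"
          using i j less.prems(2) fin by simp
      qed
      then have "?r (reflection (unit_vec i + unit_vec j) (half_spin ?B)) \<in> K"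
        using i j plus D5 spin by (intro conj span_add) simp_all
      moreover have "reflection (unit_vec i + unit_vec j) (half_spin ?B) = half_spin A"
        using i j
        by (auto simp: reflection_def inner_simps unit_vec_inner_unit_vec vec_eq_iff
            half_spin_component unit_vec_component)
      ultimately show ?thesis
        by simp
    qed
  qed
  have scale: "?r (a *\<^sub>R v) = ?r v" if "a \<in> {1, -1}" for a v
    using that by (intro restricted_reflection_scale) auto
  show ?thesis
    using \<alpha> plus minus half_spin scale unfolding E6_iff by metis
qed

lemma weyl_group_E6:
  "weyl_group E6 =
     subgroup_generated (BijGroup (span E6)) (restricted_reflection (span E6) ` generating_roots)"
  (is "_ = subgroup_generated ?B ?X")
proof -
  interpret group ?B
    by (rule group_BijGroup)
  let ?Y = "restricted_reflection (span E6) ` E6"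
  have XY: "?X \<subseteq> ?Y"
    using generating_roots_subset by blast
  have Y: "?Y \<subseteq> carrier ?B"
    by (rule root_reflections_in_BijGroup)
  have sub: "subgroup (generate ?B ?X) ?B"
    using XY Y by (intro generate_is_subgroup) blast
  have "?Y \<subseteq> generate ?B ?X"
    using generating_reflections_generate[OF sub] generate.incl[of _ ?X ?B] by blast
  then have "generate ?B ?Y \<subseteq> generate ?B ?X"
    using sub by (rule generate_subgroup_incl)
  moreover have "generate ?B ?X \<subseteq> generate ?B ?Y"
    using XY by (rule mono_generate)
  ultimately have "generate ?B ?Y = generate ?B ?X"
    by (rule subset_antisym)
  moreover have "weyl_group E6 = subgroup_generated ?B ?Y"
    by (simp add: weyl_group_def restricted_reflection_def[abs_def])
  moreover have "carrier ?B \<inter> ?X = ?X" "carrier ?B \<inter> ?Y = ?Y"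
    using XY Y by blast+
  ultimately show ?thesis
    by (simp add: subgroup_generated_def)
qed


section \<open>Embedding the root space into the parameter space\<close>

text \<open>
  On \<open>span E6\<close> this is the linear map determined by
  \<open>e\<^sub>i - e\<^sub>j \<mapsto> e\<^bsub>i+2\<^esub> - e\<^bsub>j+2\<^esub>\<close>, \<open>e\<^sub>1 + e\<^sub>2 \<mapsto> e\<^sub>1 + e\<^sub>2 + e\<^sub>3 + e\<^sub>4\<close> (the direction in which the Bailey
  transformation moves a vector), and \<open>half_spin (D5_indices - {i}) \<mapsto> e\<^bsub>i+2\<^esub> - e\<^sub>2\<close>.  The
  first two prescriptions force \<open>e\<^sub>i \<mapsto> e\<^bsub>i+2\<^esub> + (e\<^sub>1 + e\<^sub>2) / 2\<close>, the third the coefficients of \<open>h\<close>.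
\<close>

definition from_roots :: "real ^ 8 \<Rightarrow> real ^ 8" where
  "from_roots y =
    (let \<sigma> = y $ 1 + y $ 2 + y $ 3 + y $ 4 + y $ 5; h = y $ 8
     in vector [\<sigma> / 2 + 3 * h / 2, \<sigma> / 2 - h / 2,
                y $ 1 + h, y $ 2 + h, y $ 3 + h, y $ 4 + h, y $ 5 + h, 0])"

text \<open>
  The vector \<open>to_roots v\<close> is the element of \<open>span E6\<close> whose inner products with \<open>e\<^sub>i - e\<^sub>j\<close>,
  \<open>e\<^sub>1 + e\<^sub>2\<close> and \<open>half_spin (D5_indices - {i})\<close> are the linear forms \<open>v\<^bsub>i+2\<^esub> - v\<^bsub>j+2\<^esub>\<close>,
  \<open>c\<^sub>0 + c\<^sub>1 + c\<^sub>2 - s - \<delta>\<close> and \<open>v\<^bsub>i+2\<^esub> - v\<^sub>2\<close> that occur in the corresponding reflections of the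
  parameter space.
\<close>

definition to_roots :: "real ^ 8 \<Rightarrow> real ^ 8" where
  "to_roots v =
    (let w = (v $ 2 - v $ 1 - v $ 8) / 2;
         q = (v $ 2 + v $ 3 + v $ 4 + v $ 5 + v $ 6 + v $ 7) / 3 - (v $ 2 + v $ 1 + v $ 8) / 2
     in vector [v $ 3 + w, v $ 4 + w, v $ 5 + w, v $ 6 + w, v $ 7 + w, - q, - q, q])"

lemma from_roots_add: "from_roots (x + y) = from_roots x + from_roots y"
  by (simp add: from_roots_def Let_def vec_eq_iff forall_8 vector_8 field_simps)

lemma from_roots_scale: "from_roots (c *\<^sub>R x) = c *\<^sub>R from_roots x"
  by (simp add: from_roots_def Let_def vec_eq_iff forall_8 vector_8 field_simps)

lemma to_roots_add: "to_roots (x + y) = to_roots x + to_roots y"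
  by (simp add: to_roots_def Let_def vec_eq_iff forall_8 vector_8 field_simps)

lemma to_roots_in_span: "to_roots v \<in> span E6"
  by (simp add: span_E6 to_roots_def Let_def vector_8)

lemma to_roots_from_roots: "y \<in> span E6 \<Longrightarrow> to_roots (from_roots y) = y"
  by (simp add: span_E6 to_roots_def from_roots_def Let_def vec_eq_iff forall_8 vector_8 field_simps)

text \<open>
  A vector splits into a component in the image of \<open>span E6\<close> and one in the kernel of
  \<open>to_roots\<close>; the first is moved by \<open>w\<close>, transported along \<open>from_roots\<close>, and the second is kept.
\<close>

definition extend :: "(real ^ 8 \<Rightarrow> real ^ 8) \<Rightarrow> real ^ 8 \<Rightarrow> real ^ 8" where
  "extend w v = v + from_roots (w (to_roots v) - to_roots v)"

definition complexify :: "(real ^ 'n \<Rightarrow> real ^ 'n) \<Rightarrow> complex ^ 'n \<Rightarrow> complex ^ 'n" where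
  "complexify f x = (\<chi> i. Complex (f (\<chi> j. Re (x $ j)) $ i) (f (\<chi> j. Im (x $ j)) $ i))"

text \<open>
  Reading an extended map through \<open>to_roots\<close> returns the original map.  Both multiplicativity and
  injectivity of the extension follow from this.
\<close>

lemma to_roots_extend:
  assumes "w \<in> Bij (span E6)"
  shows "to_roots (extend w v) = w (to_roots v)"
proof -
  have "w (to_roots v) - to_roots v \<in> span E6"
    using Bij_imp_funcset[OF assms] to_roots_in_span by (intro span_diff) auto
  then show ?thesis
    by (simp add: extend_def to_roots_add to_roots_from_roots)
qed

lemma extend_compose:
  assumes "w \<in> Bij (span E6)" "w' \<in> Bij (span E6)"
  shows "extend (compose (span E6) w w') v = extend w (extend w' v)"
proof -
  have "extend (compose (span E6) w w') v = v + from_roots (w (w' (to_roots v)) - to_roots v)"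
    by (simp only: extend_def compose_def restrict_apply' to_roots_in_span)
  moreover have "extend w (extend w' v) =
      v + (from_roots (w' (to_roots v) - to_roots v) +
           from_roots (w (w' (to_roots v)) - w' (to_roots v)))"
    by (simp add: extend_def[of w "extend w' v"] to_roots_extend[OF assms(2)])
      (simp add: extend_def)
  ultimately show ?thesis
    by (simp flip: from_roots_add)
qed

lemma extend_id: "extend (\<lambda>x\<in>span E6. x) v = v"
  using from_roots_scale[of 0 0] by (simp add: extend_def to_roots_in_span)

lemma inj_on_extend: "inj_on extend (Bij (span E6))"
proof (rule inj_onI)
  fix w w'
  assume w: "w \<in> Bij (span E6)" "w' \<in> Bij (span E6)" and eq: "extend w = extend w'"
  have "w y = w' y" if "y \<in> span E6" for y
    using to_roots_extend[OF w(1), of "from_roots y"] to_roots_extend[OF w(2), of "from_roots y"]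
      eq that by (simp add: to_roots_from_roots)
  then show "w = w'"
    using w by (intro extensionalityI[of _ "span E6"] Bij_imp_extensional)
qed

lemma complexify_comp: "complexify (f \<circ> g) = complexify f \<circ> complexify g"
  by (simp add: complexify_def fun_eq_iff)

lemma complexify_id: "complexify id = id"
  by (simp add: complexify_def fun_eq_iff vec_eq_iff)

lemma inj_complexify: "inj complexify"
proof (rule injI)
  fix f g :: "real ^ 'n \<Rightarrow> real ^ 'n"
  assume eq: "complexify f = complexify g"
  have "f v $ i = g v $ i" for v i
    using fun_cong[OF eq, of "\<chi> j. of_real (v $ j)"] by (simp add: complexify_def vec_eq_iff)
  then show "f = g"
    by (simp add: fun_eq_iff vec_eq_iff)
qed

definition action :: "(real ^ 8 \<Rightarrow> real ^ 8) \<Rightarrow> complex ^ 8 \<Rightarrow> complex ^ 8" where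
  "action w = complexify (extend w)"

lemma action_compose:
  assumes "w \<in> Bij (span E6)" "w' \<in> Bij (span E6)"
  shows "action (compose (span E6) w w') = action w \<circ> action w'"
proof -
  have "extend (compose (span E6) w w') = extend w \<circ> extend w'"
    using extend_compose[OF assms] by auto
  then show ?thesis
    by (simp add: action_def complexify_comp)
qed

lemma action_id: "action (\<lambda>x\<in>span E6. x) = id"
proof -
  have "extend (\<lambda>x\<in>span E6. x) = id"
    by (simp add: fun_eq_iff extend_id)
  then show ?thesis
    by (simp add: action_def complexify_id)
qed

lemma action_mon: "action \<in> mon (BijGroup (span E6)) (BijGroup UNIV)"
proof -
  have "bij (action w)" if w: "w \<in> Bij (span E6)" for w
  proof -
    let ?w' = "restrict (inv_into (span E6) w) (span E6)"
    have w': "?w' \<in> Bij (span E6)"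
      using w by (rule restrict_inv_into_Bij)
    have left: "action ?w' \<circ> action w = id"
      using w w' action_compose[OF w' w] by (simp add: Bij_compose_restrict_eq action_id)
    have "compose (span E6) w ?w' = (\<lambda>x\<in>span E6. x)"
      using w by (auto simp: Bij_def bij_betw_def compose_def fun_eq_iff f_inv_into_f)
    then have "action w \<circ> action ?w' = id"
      using action_compose[OF w w'] by (simp add: action_id)
    with left show ?thesis
      by (intro o_bij)
  qed
  then have Bij_UNIV: "action w \<in> Bij UNIV" if "w \<in> Bij (span E6)" for w
    using that by (simp add: Bij_def)
  have compose_UNIV: "compose UNIV f g = f \<circ> g" for f g :: "complex ^ 8 \<Rightarrow> complex ^ 8"
    by (simp add: compose_def fun_eq_iff)
  have "action \<in> hom (BijGroup (span E6)) (BijGroup UNIV)"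
    by (intro homI)
      (simp_all add: BijGroup_def Bij_UNIV action_compose compose_UNIV)
  moreover have "inj_on action (Bij (span E6))"
    unfolding action_def[abs_def]
    using comp_inj_on[OF inj_on_extend inj_on_subset[OF inj_complexify subset_UNIV]]
    by (simp add: comp_def)
  ultimately show ?thesis
    by (simp add: mon_def BijGroup_def)
qed


section \<open>Root reflections as parameter transformations\<close>

lemma extend_restricted_reflection:
  "extend (restricted_reflection (span E6) \<alpha>) v =
     v - (2 * (to_roots v \<bullet> \<alpha>) / (\<alpha> \<bullet> \<alpha>)) *\<^sub>R from_roots \<alpha>"
proof -
  have "extend (restricted_reflection (span E6) \<alpha>) v =
      v + from_roots ((- (2 * (to_roots v \<bullet> \<alpha>) / (\<alpha> \<bullet> \<alpha>))) *\<^sub>R \<alpha>)"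
    by (simp add: extend_def restricted_reflection_def to_roots_in_span reflection_def)
  then show ?thesis
    unfolding from_roots_scale by simp
qed

lemma extend_root_reflection:
  assumes "\<alpha> \<bullet> \<alpha> = 2"
  shows "extend (restricted_reflection (span E6) \<alpha>) v = v - (to_roots v \<bullet> \<alpha>) *\<^sub>R from_roots \<alpha>"
  by (simp add: extend_restricted_reflection assms)

text \<open>
  A reflection whose root and coroot are \<open>e\<^sub>a - e\<^sub>b\<close> and \<open>v\<^sub>a - v\<^sub>b\<close> exchanges the entries \<open>a\<close> and
  \<open>b\<close>, so each transposition below only needs its root and its linear form.
\<close>

lemma action_reflection_transpose:
  assumes norm: "\<alpha> \<bullet> \<alpha> = 2" and "a \<noteq> b"
    and root: "from_roots \<alpha> = unit_vec a - unit_vec b"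
    and coroot: "\<And>v. to_roots v \<bullet> \<alpha> = v $ a - v $ b"
  shows "action (restricted_reflection (span E6) \<alpha>) = permute_params (Transposition.transpose a b)"
proof -
  have "extend (restricted_reflection (span E6) \<alpha>) v $ k = v $ Transposition.transpose a b k" for v k
    using \<open>a \<noteq> b\<close>
    by (simp add: extend_root_reflection[OF norm] root coroot unit_vec_component
        Transposition.transpose_def)
  then show ?thesis
    by (simp add: fun_eq_iff action_def complexify_def permute_params_def vec_eq_iff)
qed

lemma from_roots_unit_vec:
  assumes "i \<in> D5_indices"
  shows "from_roots (unit_vec i) = unit_vec (i + 2) + (1 / 2) *\<^sub>R (unit_vec 1 + unit_vec 2)"
  using assms unfolding D5_indices_def
  by (elim insertE emptyE)
    (simp_all add: from_roots_def Let_def vec_eq_iff forall_8 vector_8 unit_vec_component)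

lemma to_roots_component:
  assumes "i \<in> D5_indices"
  shows "to_roots v $ i = v $ (i + 2) + (v $ 2 - v $ 1 - v $ 8) / 2"
  using assms unfolding D5_indices_def
  by (elim insertE emptyE) (simp_all add: to_roots_def Let_def vector_8)

lemma action_minus:
  assumes "i \<in> D5_indices" "j \<in> D5_indices" "i \<noteq> j"
  shows "action (restricted_reflection (span E6) (unit_vec i - unit_vec j)) =
    permute_params (Transposition.transpose (i + 2) (j + 2))"
proof (rule action_reflection_transpose)
  show "(unit_vec i - unit_vec j) \<bullet> (unit_vec i - unit_vec j) = 2"
    using assms(3) by (simp add: inner_simps unit_vec_inner_unit_vec unit_vec_component)
  show "i + 2 \<noteq> j + 2"
    using assms(3) by simp
  have "from_roots (unit_vec i - unit_vec j) = from_roots (unit_vec i) - from_roots (unit_vec j)"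
    using from_roots_add[of "unit_vec i - unit_vec j" "unit_vec j"] by simp
  then show "from_roots (unit_vec i - unit_vec j) = unit_vec (i + 2) - unit_vec (j + 2)"
    using assms(1,2) by (simp add: from_roots_unit_vec)
  show "to_roots v \<bullet> (unit_vec i - unit_vec j) = v $ (i + 2) - v $ (j + 2)" for v
    using assms(1,2) by (simp add: inner_diff_right to_roots_component)
qed

lemma action_half_spin:
  assumes "i \<in> D5_indices"
  shows "action (restricted_reflection (span E6) (half_spin (D5_indices - {i}))) =
    permute_params (Transposition.transpose (i + 2) 2)"
proof (rule action_reflection_transpose)
  show "half_spin (D5_indices - {i}) \<bullet> half_spin (D5_indices - {i}) = 2"
    by (rule half_spin_norm)
  show "i + 2 \<noteq> 2"
    using assms by (auto simp: D5_indices_def)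
  \<comment> \<open>Splitting off the vector that depends on \<open>i\<close> leaves one fixed vector to evaluate.\<close>
  have split: "half_spin (D5_indices - {i}) = half_spin D5_indices + unit_vec i"
    using assms by (simp add: vec_eq_iff half_spin_component unit_vec_component)
  have "from_roots (half_spin D5_indices) = - (1 / 2) *\<^sub>R (unit_vec 1 + unit_vec 2) - unit_vec 2"
    by (simp add: from_roots_def Let_def vec_eq_iff forall_8 vector_8 unit_vec_component
        half_spin_component D5_indices_def)
  then show "from_roots (half_spin (D5_indices - {i})) = unit_vec (i + 2) - unit_vec 2"
    using assms by (simp add: split from_roots_add from_roots_unit_vec)
  have "to_roots v \<bullet> half_spin D5_indices = - (v $ 2) - (v $ 2 - v $ 1 - v $ 8) / 2" for v
    by (simp add: to_roots_def Let_def inner_vec_def sum_8 vector_8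
        half_spin_component D5_indices_def) (simp add: field_simps)
  then show "to_roots v \<bullet> half_spin (D5_indices - {i}) = v $ (i + 2) - v $ 2" for v
    using assms by (simp add: split inner_add_right to_roots_component)
qed

lemma action_plus:
  "action (restricted_reflection (span E6) (unit_vec 1 + unit_vec 2)) = bailey"
proof -
  have norm: "(unit_vec 1 + unit_vec 2) \<bullet> (unit_vec 1 + unit_vec 2) = 2"
    by (simp add: inner_simps unit_vec_inner_unit_vec unit_vec_component)
  have root: "from_roots (unit_vec 1 + unit_vec 2) =
      unit_vec 1 + unit_vec 2 + unit_vec 3 + unit_vec 4"
    by (simp add: from_roots_def Let_def vec_eq_iff forall_8 vector_8 unit_vec_component)
  have coroot: "to_roots v \<bullet> (unit_vec 1 + unit_vec 2) = v $ 2 + v $ 3 + v $ 4 - v $ 1 - v $ 8" for v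
    by (simp add: inner_add_right to_roots_def Let_def vector_8 field_simps)
  have "extend (restricted_reflection (span E6) (unit_vec 1 + unit_vec 2)) v =
      v + (v $ 1 + v $ 8 - v $ 2 - v $ 3 - v $ 4) *\<^sub>R
        (unit_vec 1 + unit_vec 2 + unit_vec 3 + unit_vec 4)" for v
    unfolding extend_root_reflection[OF norm] root coroot
    by (simp add: algebra_simps)
  then show ?thesis
    by (simp add: fun_eq_iff vec_eq_iff forall_8 action_def complexify_def unit_vec_component
        bailey_def Let_def vector_8 complex_eq_iff)
qed

lemma transpose_in_image:
  assumes "a \<in> param_indices" "b \<in> param_indices" "a \<noteq> b"
  shows "permute_params (Transposition.transpose a b) \<in>
    action ` restricted_reflection (span E6) ` generating_roots"
proof -
  have shift: "\<exists>i\<in>D5_indices. c = i + 2" if "c \<in> param_indices" "c \<noteq> 2" for c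
    using that by (auto simp: param_indices_def D5_indices_def)
  have two: "permute_params (Transposition.transpose c 2) \<in>
      action ` restricted_reflection (span E6) ` generating_roots"
    if c: "c \<in> param_indices" "c \<noteq> 2" for c
  proof -
    obtain i where i: "i \<in> D5_indices" "c = i + 2"
      using shift[OF c] by blast
    then have "half_spin (D5_indices - {i}) \<in> generating_roots"
      by (intro generating_rootsI)
    then show ?thesis
      using action_half_spin[OF i(1)] unfolding i(2) by (metis imageI)
  qed
  consider "a = 2" | "b = 2" | "a \<noteq> 2" "b \<noteq> 2"
    by blast
  then show ?thesis
  proof cases
    case 1
    then show ?thesis
      using two[of b] assms by (simp add: transpose_commute)
  next
    case 2
    then show ?thesis
      using two[of a] assms by simp
  next
    case 3
    obtain i where i: "i \<in> D5_indices" "a = i + 2"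
      using shift[OF assms(1) 3(1)] by blast
    obtain j where j: "j \<in> D5_indices" "b = j + 2"
      using shift[OF assms(2) 3(2)] by blast
    have ij: "i \<noteq> j"
      using assms(3) i j by blast
    then have "unit_vec i - unit_vec j \<in> generating_roots"
      using i j by (intro generating_rootsI)
    then show ?thesis
      using action_minus[OF i(1) j(1) ij] unfolding i(2) j(2) by (metis imageI)
  qed
qed

lemma action_generating_reflections:
  "action ` restricted_reflection (span E6) ` generating_roots \<subseteq> G1_generators"
proof -
  have perm: "permute_params (Transposition.transpose a b) \<in> G1_generators"
    if "a \<in> param_indices" "b \<in> param_indices" for a b
    using permutes_swap_id[OF that] unfolding G1_generators_def by blast
  have "2 \<in> param_indices"
    by (simp add: param_indices_def)
  moreover have "i + 2 \<in> param_indices" if "i \<in> D5_indices" for i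
    using that by (auto simp: param_indices_def D5_indices_def)
  ultimately have "permute_params (Transposition.transpose (i + 2) (j + 2)) \<in> G1_generators"
    "permute_params (Transposition.transpose (i + 2) 2) \<in> G1_generators"
    if "i \<in> D5_indices" "j \<in> D5_indices" for i j
    using that perm by blast+
  moreover have "bailey \<in> G1_generators"
    by (simp add: G1_generators_def)
  ultimately show ?thesis
    using action_minus action_half_spin action_plus
    by (auto elim!: generating_rootsE)
qed

text \<open>
  Since \<open>permute_params\<close> acts on indices, it reverses products; a transposition that is composed
  on the left of a permutation becomes a factor on the right.
\<close>

lemma permutation_in_subgroup:
  assumes K: "subgroup K (BijGroup UNIV)"
    and tr: "\<And>a b. a \<in> param_indices \<Longrightarrow> b \<in> param_indices \<Longrightarrow> a \<noteq> b \<Longrightarrow>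
      permute_params (Transposition.transpose a b) \<in> K"
    and \<pi>: "\<pi> permutes param_indices"
  shows "permute_params \<pi> \<in> K"
proof -
  have "finite param_indices"
    by (simp add: param_indices_def)
  with \<pi> show ?thesis
  proof (induction rule: permutes_induct)
    case id
    have "\<one>\<^bsub>BijGroup UNIV\<^esub> = permute_params id"
      by (simp add: BijGroup_def permute_params_def fun_eq_iff)
    then show ?case
      using subgroup.one_closed[OF K] by metis
  next
    case (swap a b p)
    let ?t = "permute_params (Transposition.transpose a b)"
    have bij: "permute_params p \<in> Bij UNIV" "?t \<in> Bij UNIV"
      using bij_permute_params[OF swap(4)] bij_permute_params[OF permutes_swap_id[OF swap(1,2)]]
      by (simp_all add: Bij_def)
    have "permute_params p \<otimes>\<^bsub>BijGroup UNIV\<^esub> ?t = permute_params (Transposition.transpose a b \<circ> p)"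
      using bij by (simp add: BijGroup_def compose_def permute_params_def fun_eq_iff)
    then show ?case
      using subgroup.m_closed[OF K swap.IH tr[OF swap(1-3)]] by metis
  qed
qed

lemma G1_eq:
  "G1 = subgroup_generated (BijGroup UNIV)
     (action ` restricted_reflection (span E6) ` generating_roots)"
  (is "_ = subgroup_generated ?B ?X")
proof -
  interpret group ?B
    by (rule group_BijGroup)
  have X: "?X \<subseteq> carrier ?B"
    using action_generating_reflections G1_generators_subset by blast
  have sub: "subgroup (generate ?B ?X) ?B"
    using X by (rule generate_is_subgroup)
  have "bailey \<in> ?X"
    using action_plus generating_rootsI(2) by (metis imageI)
  then have "G1_generators \<subseteq> generate ?B ?X"
    using permutation_in_subgroup[OF sub generate.incl[OF transpose_in_image]]
    by (auto simp: G1_generators_def intro: generate.incl)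
  then have "generate ?B G1_generators \<subseteq> generate ?B ?X"
    using sub by (rule generate_subgroup_incl)
  moreover have "generate ?B ?X \<subseteq> generate ?B G1_generators"
    using action_generating_reflections by (rule mono_generate)
  ultimately have "generate ?B G1_generators = generate ?B ?X"
    by (rule subset_antisym)
  moreover have "carrier ?B \<inter> ?X = ?X" "carrier ?B \<inter> G1_generators = G1_generators"
    using X G1_generators_subset by blast+
  ultimately show ?thesis
    by (simp add: G1_def subgroup_generated_def)
qed

lemma mon_subgroup_generated_iso:
  assumes "group G" "group H" "f \<in> mon G H" "S \<subseteq> carrier G"
  shows "subgroup_generated G S \<cong> subgroup_generated H (f ` S)"
proof -
  interpret group_hom G H f
    using assms by (simp add: group_hom_def group_hom_axioms_def mon_def)
  have "f \<in> hom (subgroup_generated G S) (subgroup_generated H (f ` S))"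
    by (rule hom_between_subgroups) simp
  moreover have "inj_on f (carrier (subgroup_generated G S))"
    using assms(3) G.carrier_subgroup_generated_subset[of S]
    by (auto simp: mon_def intro: inj_on_subset)
  ultimately have "f \<in> iso (subgroup_generated G S) (subgroup_generated H (f ` S))"
    using subgroup_generated_by_image[OF assms(4)] by (simp add: iso_def bij_betw_def)
  then show ?thesis
    by (rule is_isoI)
qed

theorem theorem3p1:
  shows "G1 \<cong> weyl_group E6"
proof -
  have "restricted_reflection (span E6) ` generating_roots \<subseteq> carrier (BijGroup (span E6))"
    using image_mono[OF generating_roots_subset] root_reflections_in_BijGroup
    by (rule subset_trans)
  then have iso: "weyl_group E6 \<cong> G1"
    unfolding weyl_group_E6 G1_eq
    by (rule mon_subgroup_generated_iso[OF group_BijGroup group_BijGroup action_mon])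
  have "group (weyl_group E6)"
    unfolding weyl_group_def by (rule group.group_subgroup_generated[OF group_BijGroup])
  then show ?thesis
    using iso by (rule group.iso_sym)
qed

end
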